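(* Let $A_0,A_1,\dots,A_{n_u}\in M_n(\mathbb{R})$, let $g\in\mathbb{R}^{n\times d}$ be a constant matrix, and consider the biaffine drift $f(x,u)=A_0x+\sum_{i=1}^{n_u}u_iA_ix$, $x\in\mathbb{R}^n$, $u\in\mathbb{R}^{n_u}$. Let $\mathfrak{F}_g=\{F_0+\sum_{i=1}^{n_u}u_iF_i:u\in\mathbb{R}^{n_u}\}$ be the family of vector fields on $\mathbb{R}^n\times\mathrm{Sym}^+(n)$ given by $$F_0(m,P)=\begin{pmatrix} A_0m \\ {} A_0P+PA_0^\top+gg^\top \end{pmatrix},\qquad F_i(m,P)=\begin{pmatrix} A_im \\ {} A_iP+PA_i^\top \end{pmatrix},\ i=1,\dots,n_u.$$ Assume that: (i) $\dim\mathrm{Lie}(A_1,\dots,A_{n_u})=n^2$; (ii) there exists $i\in\{1,\dots,n_u\}$ such that $A_igg^\top+gg^\top A_i^\top$ is nonzero. Then $\mathfrak{F}_g$ satisfies the accessibility rank condition in fixed time on an open and dense subset of $\mathbb{R}^n\times\mathrm{Sym}^+(n)$.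
   Context: $\mathrm{Sym}(n)$ (resp. $\mathrm{Sym}^+(n)$) is the set of real symmetric (resp. symmetric positive definite) $n\times n$ matrices. $\mathrm{Lie}(A_1,\dots,A_{n_u})$ is the Lie subalgebra of $M_n(\mathbb{R})$ generated by $A_1,\dots,A_{n_u}$ for the matrix commutator. For a family $\mathfrak{F}$ of smooth vector fields, with Lie bracket $[F_1,F_2]=dF_2\cdot F_1-dF_1\cdot F_2$, let $\mathcal{D}(\mathfrak{F})=\{[F_1,[\dots,[F_{k-1},F_k]\dots]]:k\ge2,\ F_i\in\mathfrak{F}\}$ and let the zero-time ideal be $\mathcal{I}(\mathfrak{F})=\mathrm{span}\{F_1-F_2,\ F_3:F_1,F_2\in\mathfrak{F},\ F_3\in\mathcal{D}(\mathfrak{F})\}$. The family satisfies the accessibility rank condition in fixed time at $X\in\mathbb{R}^n\times\mathrm{Sym}^+(n)$ if $\dim\{F(X):F\in\mathcal{I}(\mathfrak{F})\}=N$, where $N=n+\frac{n(n+1)}{2}=\dim(\mathbb{R}^n\times\mathrm{Sym}(n))$; it satisfies it on a set if it does so at every point of the set. *)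

theory Defs
  imports "HOL-Analysis.Analysis" "HOL-Library.Function_Algebras"
begin

instantiation "fun" :: (type, real_vector) real_vector
begin

definition scaleR_fun :: "real \<Rightarrow> ('a \<Rightarrow> 'b) \<Rightarrow> 'a \<Rightarrow> 'b"
  where "scaleR_fun c f = (\<lambda>x. c *\<^sub>R f x)"

instance
  by standard (auto simp: scaleR_fun_def fun_eq_iff scaleR_add_right scaleR_add_left)

end

definition is_lie_subalgebra :: "(real^'n^'n) set \<Rightarrow> bool"
  where "is_lie_subalgebra L \<longleftrightarrow>
    subspace L \<and> (\<forall>A\<in>L. \<forall>B\<in>L. A ** B - B ** A \<in> L)"

definition Lie :: "(real^'n^'n) set \<Rightarrow> (real^'n^'n) set"
  where "Lie S = is_lie_subalgebra hull S"

definition Sym :: "(real^'n^'n) set"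
  where "Sym = {P. transpose P = P}"

definition Sym_pos :: "(real^'n^'n) set"
  where "Sym_pos = {P \<in> Sym. \<forall>x. x \<noteq> 0 \<longrightarrow> x \<bullet> (P *v x) > 0}"

text \<open>
  A vector field on a manifold \<open>M\<close> that is open in an affine subspace of \<open>'a\<close> (here
  \<open>M = UNIV \<times> Sym_pos\<close>, open in \<open>UNIV \<times> Sym\<close>) is a function on the ambient space, of which
  only the values on \<open>M\<close> matter. Its differential at \<open>X\<close> is the Frechet derivative within \<open>M\<close>.
  On ambient directions not tangent to \<open>M\<close> that derivative is not unique, but the bracket only
  applies it to values of vector fields, which are tangent to \<open>M\<close>; the lemma below shows that
  there it does not depend on the choice.
\<close>

definition lie_bracket_on ::
    "'a::real_normed_vector set \<Rightarrow> ('a \<Rightarrow> 'a) \<Rightarrow> ('a \<Rightarrow> 'a) \<Rightarrow> 'a \<Rightarrow> 'a"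
  where "lie_bracket_on M F1 F2 = (\<lambda>X.
    frechet_derivative F2 (at X within M) (F1 X) - frechet_derivative F1 (at X within M) (F2 X))"

lemma frechet_derivative_within_tangent:
  fixes f :: "'a::real_normed_vector \<Rightarrow> 'b::real_normed_vector"
  assumes f: "(f has_derivative f') (at X within M)"
    and X: "X \<in> M"
    and v: "\<forall>\<^sub>F t in at 0. X + t *\<^sub>R v \<in> M"
  shows "frechet_derivative f (at X within M) v = f' v"
proof -
  define S where "S = {t::real. X + t *\<^sub>R v \<in> M}"
  obtain d where d: "d > 0" "\<And>t. t \<noteq> 0 \<Longrightarrow> dist t 0 < d \<Longrightarrow> t \<in> S"
    using v unfolding eventually_at S_def by auto
  have "ball 0 d \<subseteq> S"
  proof
    fix t :: real assume "t \<in> ball 0 d"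
    then show "t \<in> S"
      using d(2)[of t] X by (cases "t = 0") (simp_all add: S_def dist_commute)
  qed
  then have S: "at 0 within S = at 0"
    using at_within_interior interior_maximal[OF _ open_ball] d(1) centre_in_ball by blast
  have D: "((\<lambda>t. f (X + t *\<^sub>R v)) has_derivative (\<lambda>t. D (t *\<^sub>R v))) (at 0)"
    if "(f has_derivative D) (at X within M)" for D
  proof -
    have g: "((\<lambda>t. X + t *\<^sub>R v) has_derivative (\<lambda>t. t *\<^sub>R v)) (at 0 within S)"
      by (auto intro!: derivative_eq_intros)
    have "(f has_derivative D) (at (X + 0 *\<^sub>R v) within (\<lambda>t. X + t *\<^sub>R v) ` S)"
      using that by (auto simp: S_def intro: has_derivative_subset)
    from has_derivative_in_compose[OF g this] show ?thesis
      by (simp add: S)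
  qed
  have "(f has_derivative frechet_derivative f (at X within M)) (at X within M)"
    using f unfolding frechet_derivative_works[symmetric] differentiable_def by blast
  from has_derivative_unique[OF D[OF this] D[OF f]]
  have "frechet_derivative f (at X within M) (1 *\<^sub>R v) = f' (1 *\<^sub>R v)"
    by (rule fun_cong)
  then show ?thesis
    by simp
qed

text \<open>The iterated brackets \<open>[F1, [..., [F(k-1), Fk]...]]\<close> with \<open>k \<ge> 2\<close>.\<close>

inductive_set iterated_brackets ::
    "'a::real_normed_vector set \<Rightarrow> ('a \<Rightarrow> 'a) set \<Rightarrow> ('a \<Rightarrow> 'a) set"
  for M :: "'a set" and \<FF> :: "('a \<Rightarrow> 'a) set"
where
  base: "F1 \<in> \<FF> \<Longrightarrow> F2 \<in> \<FF> \<Longrightarrow> lie_bracket_on M F1 F2 \<in> iterated_brackets M \<FF>"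
| step: "F \<in> \<FF> \<Longrightarrow> G \<in> iterated_brackets M \<FF> \<Longrightarrow>
           lie_bracket_on M F G \<in> iterated_brackets M \<FF>"

definition zero_time_ideal ::
    "'a::real_normed_vector set \<Rightarrow> ('a \<Rightarrow> 'a) set \<Rightarrow> ('a \<Rightarrow> 'a) set"
  where "zero_time_ideal M \<FF> =
    span ({F1 - F2 | F1 F2. F1 \<in> \<FF> \<and> F2 \<in> \<FF>} \<union> iterated_brackets M \<FF>)"

type_synonym 'n state = "(real^'n) \<times> (real^'n^'n)"

definition state_space :: "'n::finite state set"
  where "state_space = UNIV \<times> Sym_pos"

definition fixed_time_accessibility_rank_at ::
    "('n::finite state \<Rightarrow> 'n state) set \<Rightarrow> 'n state \<Rightarrow> bool"
  where "fixed_time_accessibility_rank_at \<FF> X \<longleftrightarrow>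
    dim {F X | F. F \<in> zero_time_ideal state_space \<FF>}
      = CARD('n) + CARD('n) * (CARD('n) + 1) div 2"

definition drift_field ::
    "real^'n^'n \<Rightarrow> real^'d^'n \<Rightarrow> 'n state \<Rightarrow> 'n state"
  where "drift_field A0 g =
    (\<lambda>(m, P). (A0 *v m, A0 ** P + P ** transpose A0 + g ** transpose g))"

definition control_field ::
    "real^'n^'n \<Rightarrow> 'n state \<Rightarrow> 'n state"
  where "control_field B = (\<lambda>(m, P). (B *v m, B ** P + P ** transpose B))"

text \<open>
  The matrices are \<open>A 0, A 1, \<dots>, A nu\<close>; a control in \<open>\<real>\<close> to the power \<open>nu\<close> is a sequence \<open>u\<close>
  of which only the entries \<open>u 1, \<dots>, u nu\<close> are used.
\<close>

definition field_family ::
    "nat \<Rightarrow> (nat \<Rightarrow> real^'n^'n) \<Rightarrow> real^'d^'n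
      \<Rightarrow> ('n state \<Rightarrow> 'n state) set"
  where "field_family nu A g =
    {drift_field (A 0) g + (\<Sum>i=1..nu. u i *\<^sub>R control_field (A i)) | u :: nat \<Rightarrow> real. True}"

end

theory Submission
  imports Defs
begin

text \<open>
  All fields in play are affine: an element \<open>(B, Q)\<close> of \<open>gl(n) \<times> Sym\<close> acts by
  \<open>(m, P) \<mapsto> (B m, B P + P B\<^sup>T + Q)\<close>, and the bracket of two such fields is again of this
  form, with coefficients given by the bracket of the semidirect product of \<open>gl(n)\<close> with its
  representation \<open>P \<mapsto> B P + P B\<^sup>T\<close> on \<open>Sym\<close> (up to sign). The zero-time ideal thus becomes a
  subspace \<open>J\<close> of \<open>gl(n) \<times> Sym\<close>, and the point is that under the hypotheses \<open>J\<close> is everything.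

  Differences of members of the family put each \<open>(A\<^sub>i, 0)\<close> in \<open>J\<close> and make \<open>J\<close> stable
  under bracketing with \<open>(A\<^sub>i, 0)\<close>. The \<open>B\<close> for which bracketing with \<open>(B, 0)\<close> preserves \<open>J\<close>
  form a Lie algebra containing all \<open>A\<^sub>i\<close>, hence are all of \<open>gl(n)\<close>; then the \<open>B\<close> with
  \<open>(B, 0) \<in> J\<close> also form a Lie algebra containing all \<open>A\<^sub>i\<close>, so \<open>gl(n) \<times> 0 \<subseteq> J\<close>. Bracketing
  \<open>(A\<^sub>i, 0)\<close> with the drift \<open>(A\<^sub>0, g g\<^sup>T)\<close> and removing the first component leaves
  \<open>(0, A\<^sub>i g g\<^sup>T + g g\<^sup>T A\<^sub>i\<^sup>T)\<close>, nonzero for some \<open>i\<close>. Since \<open>Sym\<close> is an irreducible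
  representation of \<open>gl(n)\<close> (\<open>lyapunov_irreducible\<close>), also \<open>0 \<times> Sym \<subseteq> J\<close>. This is
  \<open>invariant_subspace_full\<close>.

  At a point \<open>(m, P)\<close> with \<open>m \<noteq> 0\<close> the values \<open>B m\<close> fill \<open>\<real>\<^sup>n\<close> and the free choice of \<open>Q\<close>
  fills \<open>Sym\<close>, so the rank is \<open>n + n (n + 1) / 2\<close>. The open dense set is therefore
  \<open>{(m, P). m \<noteq> 0}\<close>.
\<close>

section \<open>Matrix algebra and the action of matrices on symmetric matrices\<close>

interpretation matrix_mult: bounded_bilinear
    "(**) :: real^'n^'n \<Rightarrow> real^'n^'n \<Rightarrow> real^'n^'n"
proof -
  have "bilinear ((**) :: real^'n^'n \<Rightarrow> real^'n^'n \<Rightarrow> real^'n^'n)"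
    unfolding bilinear_def
    by (auto intro!: linearI
        simp: vec_eq_iff matrix_matrix_mult_def sum.distrib sum_distrib_left algebra_simps)
  then show "bounded_bilinear ((**) :: real^'n^'n \<Rightarrow> real^'n^'n \<Rightarrow> real^'n^'n)"
    by (simp add: bilinear_conv_bounded_bilinear)
qed

lemma linear_transpose: "linear (transpose :: real^'n^'m \<Rightarrow> real^'m^'n)"
  by (auto intro!: linearI simp: transpose_def vec_eq_iff)

lemmas matrix_ring_simps =
  matrix_mult.add_left matrix_mult.add_right matrix_mult.diff_left matrix_mult.diff_right
  matrix_mult.scaleR_left matrix_mult.scaleR_right matrix_mult.minus_left matrix_mult.minus_right
  linear_add[OF linear_transpose] linear_diff[OF linear_transpose]
  linear_scale[OF linear_transpose] linear_neg[OF linear_transpose]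
  linear_0[OF linear_transpose] matrix_transpose_mul matrix_mul_assoc

lemma Sym_nth:
  assumes "Q \<in> Sym"
  shows "Q $ i $ j = Q $ j $ i"
proof -
  have "transpose Q $ i $ j = Q $ i $ j"
    using assms by (simp add: Sym_def)
  then show ?thesis
    by (simp add: transpose_def)
qed

lemma subspace_Sym: "subspace (Sym :: (real^'n^'n) set)"
  by (auto simp: subspace_def Sym_def matrix_ring_simps)

definition lyapunov :: "real^'n^'n \<Rightarrow> real^'n^'n \<Rightarrow> real^'n^'n"
  where "lyapunov B Q = B ** Q + Q ** transpose B"

interpretation lyapunov: bounded_bilinear
    "lyapunov :: real^'n^'n \<Rightarrow> real^'n^'n \<Rightarrow> real^'n^'n"
proof -
  have "bilinear (lyapunov :: real^'n^'n \<Rightarrow> real^'n^'n \<Rightarrow> real^'n^'n)"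
    unfolding bilinear_def
    by (auto intro!: linearI simp: lyapunov_def matrix_ring_simps algebra_simps)
  then show "bounded_bilinear (lyapunov :: real^'n^'n \<Rightarrow> real^'n^'n \<Rightarrow> real^'n^'n)"
    by (simp add: bilinear_conv_bounded_bilinear)
qed

text \<open>The map \<open>B \<mapsto> lyapunov B\<close> is a representation of the Lie algebra of matrices.\<close>

lemma lyapunov_commutator:
  "lyapunov (B ** C - C ** B) Q = lyapunov B (lyapunov C Q) - lyapunov C (lyapunov B Q)"
  by (simp add: lyapunov_def matrix_ring_simps algebra_simps)

lemma lyapunov_Sym: "Q \<in> Sym \<Longrightarrow> lyapunov B Q \<in> Sym"
  by (simp add: lyapunov_def Sym_def matrix_ring_simps algebra_simps)

section \<open>Affine fields and their Lie brackets\<close>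

text \<open>
  The sign is opposite to the usual bracket of the semidirect product, in agreement with the
  convention \<open>[F\<^sub>1, F\<^sub>2] = dF\<^sub>2 F\<^sub>1 - dF\<^sub>1 F\<^sub>2\<close> for vector fields.
\<close>

definition affine_bracket ::
    "(real^'n^'n) \<times> (real^'n^'n) \<Rightarrow> (real^'n^'n) \<times> (real^'n^'n)
      \<Rightarrow> (real^'n^'n) \<times> (real^'n^'n)"
  where "affine_bracket p q =
    (fst q ** fst p - fst p ** fst q, lyapunov (fst q) (snd p) - lyapunov (fst p) (snd q))"

text \<open>
  Equality is demanded on the manifold only, because iterated brackets have unspecified values off
  it. Symmetry of the constant term makes the field tangent to the manifold.
\<close>

definition represents ::
    "('n::finite state \<Rightarrow> 'n state) \<Rightarrow> (real^'n^'n) \<times> (real^'n^'n) \<Rightarrow> bool"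
  where "represents F p \<longleftrightarrow>
    snd p \<in> Sym \<and> (\<forall>X\<in>state_space. F X = control_field (fst p) X + (0, snd p))"

lemma control_field_apply: "control_field B X = (B *v fst X, lyapunov B (snd X))"
  by (simp add: control_field_def lyapunov_def case_prod_unfold)

lemma bounded_linear_control_field: "bounded_linear (control_field B)"
proof -
  have "linear (control_field B)"
    by (auto intro!: linearI simp: control_field_apply lyapunov.add_right lyapunov.scaleR_right
        algebra_simps)
  then show ?thesis
    by (simp add: linear_conv_bounded_linear)
qed

text \<open>
  A positive definite form is at least \<open>c > 0\<close> on the compact unit sphere, where a
  perturbation \<open>t S\<close> contributes at most \<open>\<bar>t\<bar>\<close> times the operator norm of \<open>S\<close>.
\<close>

lemma Sym_pos_open_in_Sym:
  fixes P S :: "real^'n^'n"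
  assumes P: "P \<in> Sym_pos" and S: "S \<in> Sym"
  shows "\<forall>\<^sub>F t in at 0. P + t *\<^sub>R S \<in> Sym_pos"
proof -
  have "compact (sphere 0 1 :: (real^'n) set)" "sphere 0 1 \<noteq> ({} :: (real^'n) set)"
    by auto
  moreover have "continuous_on (sphere 0 1) (\<lambda>x. x \<bullet> (P *v x))"
    by (intro continuous_intros linear_continuous_on matrix_vector_mul_bounded_linear)
  ultimately obtain x0 where x0: "x0 \<in> sphere 0 1"
    and min: "\<And>x. x \<in> sphere 0 1 \<Longrightarrow> x0 \<bullet> (P *v x0) \<le> x \<bullet> (P *v x)"
    using continuous_attains_inf[of "sphere 0 1" "\<lambda>x. x \<bullet> (P *v x)"] by auto
  define c where "c = x0 \<bullet> (P *v x0)"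
  define K where "K = onorm ((*v) S)"
  have c: "c > 0"
    using P x0 by (cases "x0 = 0") (auto simp: Sym_pos_def c_def)
  have K: "K \<ge> 0"
    unfolding K_def by (rule onorm_pos_le[OF matrix_vector_mul_bounded_linear])
  \<comment> \<open>The denominator is \<open>K + 1\<close> rather than \<open>K\<close> to allow for \<open>S = 0\<close>.\<close>
  have pos: "P + t *\<^sub>R S \<in> Sym_pos" if t: "\<bar>t\<bar> < c / (K + 1)" for t
  proof -
    have tK: "\<bar>t\<bar> * K < c"
    proof -
      have "\<bar>t\<bar> * (K + 1) < c"
        using t K by (simp add: pos_less_divide_eq)
      then show ?thesis by (simp add: algebra_simps)
    qed
    have "0 < x \<bullet> ((P + t *\<^sub>R S) *v x)" if "x \<noteq> 0" for x
    proof -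
      define y where "y = x /\<^sub>R norm x"
      have y: "norm y = 1" and xy: "x = norm x *\<^sub>R y"
        using that by (simp_all add: y_def)
      have "\<bar>y \<bullet> (S *v y)\<bar> \<le> norm y * norm (S *v y)"
        by (rule Cauchy_Schwarz_ineq2)
      also have "\<dots> \<le> K"
        using onorm[OF matrix_vector_mul_bounded_linear, of S y] by (simp add: y K_def)
      finally have "\<bar>t * (y \<bullet> (S *v y))\<bar> \<le> \<bar>t\<bar> * K"
        by (simp add: abs_mult mult_left_mono)
      moreover have "c \<le> y \<bullet> (P *v y)"
        using min[of y] y by (simp add: c_def)
      ultimately have "0 < y \<bullet> (P *v y) + t * (y \<bullet> (S *v y))"
        using tK by linarith
      also have "\<dots> = y \<bullet> ((P + t *\<^sub>R S) *v y)"
        by (simp add: algebra_simps inner_add_right scaleR_matrix_vector_assoc[symmetric])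
      finally have "0 < norm x * (norm x * (y \<bullet> ((P + t *\<^sub>R S) *v y)))"
        using that by simp
      also have "\<dots> = x \<bullet> ((P + t *\<^sub>R S) *v x)"
        by (subst (3 4) xy) (simp add: matrix_vector_mult_scaleR)
      finally show ?thesis .
    qed
    moreover have "P + t *\<^sub>R S \<in> Sym"
      using P S by (auto simp: Sym_pos_def intro: subspace_add subspace_scale subspace_Sym)
    ultimately show ?thesis
      by (simp add: Sym_pos_def)
  qed
  show ?thesis
    unfolding eventually_at
    by (rule exI[of _ "c / (K + 1)"]) (use c K pos in auto)
qed

lemma state_space_tangent:
  assumes "X \<in> state_space" and "snd v \<in> Sym"
  shows "\<forall>\<^sub>F t in at 0. X + t *\<^sub>R v \<in> state_space"
  using Sym_pos_open_in_Sym[of "snd X" "snd v"] assms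
  by (auto simp: state_space_def mem_Times_iff)

lemma represents_tangent:
  assumes "represents F p" and "X \<in> state_space"
  shows "snd (F X) \<in> Sym"
  using assms by (auto simp: represents_def control_field_apply state_space_def Sym_pos_def
      intro!: subspace_add[OF subspace_Sym] lyapunov_Sym)

lemma represents_derivative:
  assumes F: "represents F p" and X: "X \<in> state_space" and v: "snd v \<in> Sym"
  shows "frechet_derivative F (at X within state_space) v = control_field (fst p) v"
proof -
  have "((\<lambda>X. control_field (fst p) X + (0, snd p)) has_derivative control_field (fst p))
      (at X within state_space)"
    by (auto intro!: derivative_eq_intros bounded_linear.has_derivative[OF bounded_linear_control_field])
  then have "(F has_derivative control_field (fst p)) (at X within state_space)"
    using F X by (auto simp: represents_def intro: has_derivative_transform)
  then show ?thesis
    using frechet_derivative_within_tangent X state_space_tangent[OF X v] by blast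
qed

text \<open>
  The fields are affine, so their derivatives are their linear parts; the terms that are linear in
  the point combine to a single linear field by \<open>lyapunov_commutator\<close>.
\<close>

lemma represents_lie_bracket:
  assumes F: "represents F p" and G: "represents G q"
  shows "represents (lie_bracket_on state_space F G) (affine_bracket p q)"
  unfolding represents_def
proof (intro conjI ballI)
  show "snd (affine_bracket p q) \<in> Sym"
    using F G by (auto simp: represents_def affine_bracket_def
        intro!: subspace_diff[OF subspace_Sym] lyapunov_Sym)
  fix X :: "'a state"
  assume X: "X \<in> state_space"
  have "lie_bracket_on state_space F G X =
      control_field (fst q) (F X) - control_field (fst p) (G X)"
    unfolding lie_bracket_on_def
    using represents_derivative[OF F X] represents_derivative[OF G X]
      represents_tangent[OF F X] represents_tangent[OF G X] by simp
  also have "\<dots> = control_field (fst (affine_bracket p q)) X + (0, snd (affine_bracket p q))"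
    using F G X lyapunov_commutator[of "fst q" "fst p" "snd X"]
    by (simp add: represents_def control_field_apply affine_bracket_def lyapunov.add_right
        lyapunov.diff_left matrix_vector_mul_assoc algebra_simps)
  finally show "lie_bracket_on state_space F G X = \<dots>" .
qed

lemma represents_add:
  "represents F p \<Longrightarrow> represents G q \<Longrightarrow> represents (F + G) (p + q)"
  by (auto simp: represents_def control_field_apply lyapunov.add_left algebra_simps
      intro: subspace_add[OF subspace_Sym])

lemma represents_scaleR:
  "represents F p \<Longrightarrow> represents (c *\<^sub>R F) (c *\<^sub>R p)"
  by (auto simp: represents_def control_field_apply lyapunov.scaleR_left scaleR_fun_def
      scaleR_matrix_vector_assoc scaleR_add_right
      intro: subspace_scale[OF subspace_Sym])

lemma represents_diff:
  assumes "represents F p" and "represents G q"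
  shows "represents (F - G) (p - q)"
  using represents_add[OF assms(1) represents_scaleR[OF assms(2), of "-1"]]
  by simp

lemma represents_0: "represents 0 0"
  by (simp add: represents_def control_field_apply subspace_0[OF subspace_Sym] lyapunov.zero_left
      zero_prod_def)

text \<open>
  Taking \<open>m\<close> arbitrary and \<open>P\<close> the identity already determines the coefficients. Hence
  what is shown for one representing pair of a field holds for all of them.
\<close>

lemma represents_unique:
  fixes F :: "'n::finite state \<Rightarrow> 'n state"
  assumes p: "represents F p" and q: "represents F q"
  shows "p = q"
proof -
  have "(mat 1 :: real^'n^'n) \<in> Sym_pos"
    by (simp add: Sym_pos_def Sym_def)
  then have X: "(m, mat 1) \<in> state_space" for m :: "real^'n"
    by (simp add: state_space_def)
  have eq: "control_field (fst p) (m, mat 1) + (0, snd p) =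
      control_field (fst q) (m, mat 1) + (0, snd q)" for m :: "real^'n"
    using bspec[OF conjunct2[OF p[unfolded represents_def]] X[of m]]
      bspec[OF conjunct2[OF q[unfolded represents_def]] X[of m]] by (rule trans[OF sym])
  have "fst p *v m = fst q *v m" for m
    using arg_cong[OF eq[of m], of fst] by (simp add: control_field_apply)
  then have "fst p = fst q"
    by (subst matrix_eq) blast
  with eq[of 0] show ?thesis
    by (simp add: prod_eq_iff)
qed

lemma affine_bracket_linear_right: "linear (affine_bracket p)"
  by (auto intro!: linearI simp: affine_bracket_def matrix_ring_simps lyapunov.add_left
      lyapunov.add_right lyapunov.scaleR_left lyapunov.scaleR_right algebra_simps)

lemma affine_bracket_antisym: "affine_bracket p q = - affine_bracket q p"
  by (simp add: affine_bracket_def)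

lemma affine_bracket_linear_left: "linear (\<lambda>p. affine_bracket p q)"
  using linear_compose[OF affine_bracket_linear_right[of q] linear_uminus]
  by (simp add: affine_bracket_antisym[of _ q] o_def)

text \<open>The instance of the Jacobi identity in which two of the elements have no constant term.\<close>

lemma affine_bracket_commutator:
  "affine_bracket (B ** C - C ** B, 0) p =
    affine_bracket (C, 0) (affine_bracket (B, 0) p) -
    affine_bracket (B, 0) (affine_bracket (C, 0) p)"
  by (simp add: affine_bracket_def lyapunov_commutator matrix_ring_simps lyapunov.zero_right
      lyapunov.minus_right algebra_simps)

section \<open>Irreducibility of the action on symmetric matrices\<close>

definition outer :: "real^'n \<Rightarrow> real^'n \<Rightarrow> real^'n^'n"
  where "outer x y = (\<chi> i j. x $ i * y $ j)"

lemma outer_scaleR_left: "outer (c *\<^sub>R x) z = c *\<^sub>R outer x z"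
  and outer_scaleR_right: "outer z (c *\<^sub>R x) = c *\<^sub>R outer z x"
  by (simp_all add: outer_def vec_eq_iff algebra_simps)

lemma transpose_outer: "transpose (outer x y) = outer y x"
  by (simp add: outer_def transpose_def vec_eq_iff)

lemma outer_vector_mult: "outer x y *v z = (y \<bullet> z) *\<^sub>R x"
  by (simp add: outer_def matrix_vector_mult_def vec_eq_iff inner_vec_def sum_distrib_left mult_ac)

lemma matrix_mult_outer: "B ** outer x y = outer (B *v x) y"
  by (simp add: outer_def matrix_vector_mult_def matrix_matrix_mult_def vec_eq_iff
      sum_distrib_left mult_ac)

lemma outer_matrix_mult: "outer x y ** B = outer x (transpose B *v y)"
  by (simp add: outer_def matrix_vector_mult_def matrix_matrix_mult_def vec_eq_iff
      sum_distrib_left mult_ac transpose_def del: transpose_matrix_vector)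

lemma lyapunov_outer:
  "lyapunov B (outer x y + outer y x) =
    (outer (B *v x) y + outer y (B *v x)) + (outer x (B *v y) + outer (B *v y) x)"
  by (simp add: lyapunov_def matrix_ring_simps matrix_mult_outer outer_matrix_mult
      del: transpose_matrix_vector)

lemma lyapunov_outer_Sym:
  assumes "Q \<in> Sym"
  shows "lyapunov (outer y x) Q = outer y (Q *v x) + outer (Q *v x) y"
proof -
  have "transpose Q = Q"
    using assms by (simp add: Sym_def)
  then show ?thesis
    by (simp add: lyapunov_def transpose_outer matrix_mult_outer outer_matrix_mult
        del: transpose_matrix_vector)
qed

text \<open>
  Half the sum of \<open>e\<^sub>i q\<^sub>i\<^sup>T + q\<^sub>i e\<^sub>i\<^sup>T\<close> over the rows \<open>q\<^sub>i\<close> of a symmetric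
  matrix gives back that matrix.
\<close>

lemma Sym_spanned_by_outer:
  fixes W :: "(real^'n^'n) set"
  assumes W: "subspace W" and outer: "\<And>x y. outer x y + outer y x \<in> W"
  shows "Sym \<subseteq> W"
proof
  fix Q :: "real^'n^'n"
  assume "Q \<in> Sym"
  note Q = Sym_nth[OF this]
  have "Q = (1/2) *\<^sub>R (\<Sum>i\<in>UNIV. outer (axis i 1) (Q $ i) + outer (Q $ i) (axis i 1))"
  proof -
    have "(\<Sum>i\<in>UNIV. axis i 1 $ k * Q $ i $ l) = Q $ k $ l" for k l
      by (simp add: axis_def if_distrib [of "\<lambda>a. a * _"] cong: if_cong)
    moreover have "(\<Sum>i\<in>UNIV. Q $ i $ k * axis i 1 $ l) = Q $ k $ l" for k l
      by (simp add: axis_def if_distrib [of "\<lambda>a. _ * a"] Q[of l k] cong: if_cong)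
    ultimately show ?thesis
      by (simp add: vec_eq_iff outer_def sum.distrib)
  qed
  moreover have "(1/2) *\<^sub>R (\<Sum>i\<in>UNIV. outer (axis i 1) (Q $ i) + outer (Q $ i) (axis i 1)) \<in> W"
    by (intro subspace_scale[OF W] subspace_sum[OF W] outer)
  ultimately show "Q \<in> W"
    by simp
qed

text \<open>
  Choose \<open>w = Q z \<noteq> 0\<close>. Acting on \<open>Q\<close> by the rank-one matrix \<open>v z\<^sup>T\<close> gives
  \<open>v w\<^sup>T + w v\<^sup>T\<close>, so all these lie in \<open>W\<close>. Acting on \<open>y w\<^sup>T + w y\<^sup>T\<close> by a rank-one matrix
  that sends \<open>w\<close> to \<open>x\<close> gives \<open>x y\<^sup>T + y x\<^sup>T\<close>, up to a term of the previous kind.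
\<close>

lemma lyapunov_irreducible:
  fixes W :: "(real^'n^'n) set"
  assumes W: "subspace W"
    and invariant: "\<And>B Q. Q \<in> W \<Longrightarrow> lyapunov B Q \<in> W"
    and Q: "Q \<in> W" "Q \<in> Sym" "Q \<noteq> 0"
  shows "Sym \<subseteq> W"
proof (rule Sym_spanned_by_outer[OF W])
  fix x y :: "real^'n"
  obtain z where z: "Q *v z \<noteq> 0"
    using Q(3) by (metis matrix_eq matrix_vector_mult_0)
  define w where "w = Q *v z"
  have w: "outer v w + outer w v \<in> W" for v
    using invariant[OF Q(1), of "outer v z"] by (simp add: lyapunov_outer_Sym[OF Q(2)] w_def)
  define B where "B = outer x ((1 / (w \<bullet> w)) *\<^sub>R w)"
  have Bw: "B *v w = x"
    using z by (simp add: B_def outer_vector_mult w_def)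
  define c where "c = (w \<bullet> y) / (w \<bullet> w)"
  have By: "B *v y = c *\<^sub>R x"
    by (simp add: B_def outer_vector_mult c_def)
  have "lyapunov B (outer y w + outer w y) =
      c *\<^sub>R (outer x w + outer w x) + (outer x y + outer y x)"
    by (simp add: lyapunov_outer Bw By outer_scaleR_left outer_scaleR_right scaleR_add_right)
  with invariant[OF w[of y], of B] have "c *\<^sub>R (outer x w + outer w x) + (outer x y + outer y x) \<in> W"
    by simp
  from subspace_diff[OF W this subspace_scale[OF W w[of x], of c]]
  show "outer x y + outer y x \<in> W"
    by simp
qed

section \<open>Invariant subspaces of coefficients\<close>

text \<open>The form in which the dimension hypothesis on \<open>Lie\<close> is used.\<close>

lemma lie_subalgebra_eq_UNIV:
  fixes L S :: "(real^'n^'n) set"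
  assumes dim: "dim (Lie S) = CARD('n)^2" and L: "is_lie_subalgebra L" and S: "S \<subseteq> L"
  shows "L = UNIV"
proof -
  have "span (Lie S) = UNIV"
    using dim by (simp add: dim_eq_full[symmetric] power2_eq_square)
  moreover have "Lie S \<subseteq> L"
    unfolding Lie_def using S L by (rule hull_minimal)
  moreover have "subspace L"
    using L by (simp add: is_lie_subalgebra_def)
  ultimately show ?thesis
    by (metis span_minimal top.extremum_uniqueI)
qed

text \<open>
  The algebraic core. The dimension hypothesis is applied twice: to the normaliser \<open>N\<close>, and then
  to \<open>K = {B. (B, 0) \<in> J}\<close>, whose closure under commutators comes from \<open>N\<close> being
  everything. The drift then produces a nonzero element of \<open>J\<close> without linear part.
\<close>

lemma invariant_subspace_full:
  fixes J :: "((real^'n^'n) \<times> (real^'n^'n)) set" and S :: "(real^'n^'n) set"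
  assumes J: "subspace J"
    and dim: "dim (Lie S) = CARD('n)^2"
    and S: "\<And>B. B \<in> S \<Longrightarrow> (B, 0) \<in> J"
    and invariant: "\<And>B p. B \<in> S \<Longrightarrow> p \<in> J \<Longrightarrow> affine_bracket (B, 0) p \<in> J"
    and drift: "\<And>p. p \<in> J \<Longrightarrow> affine_bracket (A, R) p \<in> J"
    and R: "R \<in> Sym" "\<exists>B\<in>S. lyapunov B R \<noteq> 0"
  shows "UNIV \<times> Sym \<subseteq> J"
proof -
  define N where "N = {B. \<forall>p\<in>J. affine_bracket (B, 0) p \<in> J}"
  have "affine_bracket (B + C, 0) p = affine_bracket (B, 0) p + affine_bracket (C, 0) p"
    "affine_bracket (c *\<^sub>R B, 0) p = c *\<^sub>R affine_bracket (B, 0) p"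
    "affine_bracket (0, 0) p = 0" for B C :: "real^'n^'n" and c p
    using linear_add[OF affine_bracket_linear_left[of p], of "(B, 0)" "(C, 0)"]
      linear_scale[OF affine_bracket_linear_left[of p], of c "(B, 0)"]
      linear_0[OF affine_bracket_linear_left[of p]]
    by (simp_all add: zero_prod_def)
  then have "subspace N"
    unfolding N_def by (intro subspaceI)
      (auto intro: subspace_add[OF J] subspace_scale[OF J] subspace_0[OF J])
  then have "is_lie_subalgebra N"
    by (auto simp: N_def is_lie_subalgebra_def affine_bracket_commutator
        intro: subspace_diff[OF J])
  then have "N = UNIV"
    by (rule lie_subalgebra_eq_UNIV[OF dim]) (auto simp: N_def invariant)
  then have all_invariant: "affine_bracket (B, 0) p \<in> J" if "p \<in> J" for B p
    using that by (auto simp: N_def)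
  define K where "K = {B. (B, 0) \<in> J}"
  have "(B ** C - C ** B, 0) \<in> J" if "(B, 0) \<in> J" for B C
    using all_invariant[OF that, of C] by (simp add: affine_bracket_def lyapunov.zero_right)
  moreover have "(B + C, 0) \<in> J" if "(B, 0) \<in> J" "(C, 0) \<in> J" for B C
    using subspace_add[OF J that] by simp
  moreover have "(c *\<^sub>R B, 0) \<in> J" if "(B, 0) \<in> J" for B c
    using subspace_scale[OF J that, of c] by simp
  ultimately have "is_lie_subalgebra K"
    using subspace_0[OF J]
    by (auto simp: K_def is_lie_subalgebra_def subspace_def zero_prod_def)
  then have "K = UNIV"
    by (rule lie_subalgebra_eq_UNIV[OF dim]) (auto simp: K_def S)
  then have linear_part: "(B, 0) \<in> J" for B
    by (auto simp: K_def)
  define W where "W = {Q. (0, Q) \<in> J}"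
  have "(0, P + Q) \<in> J" if "(0, P) \<in> J" "(0, Q) \<in> J" for P Q
    using subspace_add[OF J that] by simp
  moreover have "(0, c *\<^sub>R Q) \<in> J" if "(0, Q) \<in> J" for Q c
    using subspace_scale[OF J that, of c] by simp
  ultimately have W: "subspace W"
    using subspace_0[OF J] by (auto simp: W_def subspace_def zero_prod_def)
  have W_invariant: "lyapunov B Q \<in> W" if "Q \<in> W" for B Q
    using subspace_neg[OF J all_invariant[of "(0, Q)" B]] that
    by (simp add: W_def affine_bracket_def lyapunov.zero_left)
  obtain B where "lyapunov B R \<noteq> 0"
    using R by blast
  moreover have "(0, lyapunov B R) \<in> J"
    using subspace_diff[OF J drift[OF linear_part[of B]] linear_part[of "B ** A - A ** B"]]
    by (simp add: affine_bracket_def lyapunov.zero_right)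
  then have "lyapunov B R \<in> W"
    by (simp add: W_def)
  ultimately have "Sym \<subseteq> W"
    using lyapunov_irreducible[OF W W_invariant] lyapunov_Sym[OF R(1)] by blast
  then have "(0, Q) \<in> J" if "Q \<in> Sym" for Q
    using that by (auto simp: W_def)
  then have "(B, Q) \<in> J" if "Q \<in> Sym" for B Q
    using subspace_add[OF J linear_part[of B], of "(0, Q)"] that by simp
  then show ?thesis
    by auto
qed

section \<open>Coefficients of the zero-time ideal\<close>

definition ideal_coefficients ::
    "('n::finite state \<Rightarrow> 'n state) set \<Rightarrow> ((real^'n^'n) \<times> (real^'n^'n)) set"
  where "ideal_coefficients \<FF> = {p. \<exists>F\<in>zero_time_ideal state_space \<FF>. represents F p}"

lemma subspace_zero_time_ideal: "subspace (zero_time_ideal M \<FF>)"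
  by (simp add: zero_time_ideal_def)

lemma subspace_ideal_coefficients: "subspace (ideal_coefficients \<FF>)"
  unfolding ideal_coefficients_def
  by (rule subspaceI)
    (blast intro: represents_0 represents_add represents_scaleR
      subspace_0 subspace_add subspace_scale subspace_zero_time_ideal)+

lemma ideal_coefficients_diff:
  assumes "F \<in> \<FF>" "G \<in> \<FF>" "represents F p" "represents G q"
  shows "p - q \<in> ideal_coefficients \<FF>"
proof -
  have "F - G \<in> zero_time_ideal state_space \<FF>"
    unfolding zero_time_ideal_def using assms by (blast intro: span_base)
  then show ?thesis
    using represents_diff[OF assms(3,4)] by (auto simp: ideal_coefficients_def)
qed

lemma iterated_brackets_coefficients:
  assumes "F \<in> iterated_brackets state_space \<FF>" and "represents F p"
  shows "p \<in> ideal_coefficients \<FF>"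
  unfolding ideal_coefficients_def zero_time_ideal_def
  using assms by (blast intro: span_base)

lemma iterated_brackets_represented:
  assumes "F \<in> iterated_brackets state_space \<FF>"
    and "\<And>F. F \<in> \<FF> \<Longrightarrow> \<exists>p. represents F p"
  shows "\<exists>p. represents F p"
  using assms by (induction rule: iterated_brackets.induct) (blast intro: represents_lie_bracket)+

text \<open>
  The zero-time ideal is an ideal: bracketing with a member of the family preserves it. Since the
  ideal is a span of functions whose brackets are well behaved only on the manifold, the claim
  is phrased on coefficients and proved along with their existence. A bracket with
  \<open>F\<^sub>1 - F\<^sub>2\<close> is a difference of two brackets of members of the family.
\<close>

lemma zero_time_ideal_represented:
  assumes F: "F \<in> zero_time_ideal state_space \<FF>"
    and rep: "\<And>F. F \<in> \<FF> \<Longrightarrow> \<exists>p. represents F p"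
  shows "\<exists>p. represents F p \<and>
    (\<forall>H\<in>\<FF>. \<forall>h. represents H h \<longrightarrow> affine_bracket h p \<in> ideal_coefficients \<FF>)"
  using F unfolding zero_time_ideal_def
proof (induction rule: span_induct)
  case base
  let ?J = "ideal_coefficients \<FF>"
  let ?P = "\<lambda>F p. represents F p \<and> (\<forall>H\<in>\<FF>. \<forall>h. represents H h \<longrightarrow> affine_bracket h p \<in> ?J)"
  show ?case
  proof (rule subspaceI)
    have "?P 0 0"
      by (simp add: represents_0 linear_0[OF affine_bracket_linear_right]
          subspace_0[OF subspace_ideal_coefficients])
    then show "0 \<in> {F. \<exists>p. ?P F p}"
      by blast
  next
    fix F G
    assume "F \<in> {F. \<exists>p. ?P F p}" "G \<in> {F. \<exists>p. ?P F p}"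
    then obtain p q where "?P F p" "?P G q"
      by blast
    then have "?P (F + G) (p + q)"
      by (simp add: represents_add linear_add[OF affine_bracket_linear_right]
          subspace_add[OF subspace_ideal_coefficients])
    then show "F + G \<in> {F. \<exists>p. ?P F p}"
      by blast
  next
    fix c F
    assume "F \<in> {F. \<exists>p. ?P F p}"
    then obtain p where "?P F p"
      by blast
    then have "?P (c *\<^sub>R F) (c *\<^sub>R p)"
      by (simp add: represents_scaleR linear_scale[OF affine_bracket_linear_right]
          subspace_scale[OF subspace_ideal_coefficients])
    then show "c *\<^sub>R F \<in> {F. \<exists>p. ?P F p}"
      by blast
  qed
next
  case (step F)
  have bracket: "affine_bracket h p \<in> ideal_coefficients \<FF>"
    if "H \<in> \<FF>" "represents H h" "represents F p" "F \<in> \<FF> \<or> F \<in> iterated_brackets state_space \<FF>"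
    for F H h p
  proof -
    have "lie_bracket_on state_space H F \<in> iterated_brackets state_space \<FF>"
      using that(4) iterated_brackets.base[OF that(1)] iterated_brackets.step[OF that(1)]
      by (elim disjE)
    then show ?thesis
      by (rule iterated_brackets_coefficients) (rule represents_lie_bracket[OF that(2,3)])
  qed
  from step show ?case
  proof
    assume "F \<in> {F1 - F2 | F1 F2. F1 \<in> \<FF> \<and> F2 \<in> \<FF>}"
    then obtain F1 F2 where F: "F = F1 - F2" "F1 \<in> \<FF>" "F2 \<in> \<FF>"
      by blast
    obtain p1 p2 where p: "represents F1 p1" "represents F2 p2"
      using rep F by meson
    have "affine_bracket h (p1 - p2) \<in> ideal_coefficients \<FF>"
      if H: "H \<in> \<FF>" "represents H h" for H h
      unfolding linear_diff[OF affine_bracket_linear_right]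
      using bracket[OF H p(1)] bracket[OF H p(2)] F(2,3)
      by (simp add: subspace_diff[OF subspace_ideal_coefficients])
    moreover have "represents F (p1 - p2)"
      unfolding F(1) by (rule represents_diff[OF p])
    ultimately show ?thesis
      by blast
  next
    assume F: "F \<in> iterated_brackets state_space \<FF>"
    obtain p where "represents F p"
      using iterated_brackets_represented[OF F rep] by blast
    then show ?thesis
      using bracket[of _ _ F p] F by blast
  qed
qed

lemma ideal_coefficients_invariant:
  assumes rep: "\<And>F. F \<in> \<FF> \<Longrightarrow> \<exists>p. represents F p"
    and "H \<in> \<FF>" "represents H h" "p \<in> ideal_coefficients \<FF>"
  shows "affine_bracket h p \<in> ideal_coefficients \<FF>"
proof -
  obtain F where F: "F \<in> zero_time_ideal state_space \<FF>" "represents F p"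
    using assms(4) by (auto simp: ideal_coefficients_def)
  then show ?thesis
    using zero_time_ideal_represented[OF F(1) rep] assms(2,3) represents_unique[OF F(2)] by blast
qed

section \<open>The rank at a point with nonzero mean\<close>

text \<open>
  Enumerate the index type by \<open>h\<close>. Truncation to the upper triangle is a linear isomorphism from
  \<open>Sym\<close> onto the span of the standard basis matrices in positions \<open>(i, j)\<close> with
  \<open>h i \<le> h j\<close>, and there are \<open>1 + \<dots> + n\<close> of these.
\<close>

lemma dim_Sym: "dim (Sym :: (real^'n^'n) set) = CARD('n) * (CARD('n) + 1) div 2"
proof -
  obtain h :: "'n \<Rightarrow> nat" where h: "bij_betw h UNIV {0..<CARD('n)}"
    using ex_bij_betw_finite_nat[of "UNIV :: 'n set"] by auto
  then have inj: "inj h"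
    by (simp add: bij_betw_def)
  define D where "D = {ij. h (fst ij) \<le> h (snd ij)}"
  define e where "e = (\<lambda>ij :: 'n \<times> 'n. axis (fst ij) (axis (snd ij) 1) :: real^'n^'n)"
  define T where "T = {M :: real^'n^'n. \<forall>b\<in>Basis. b \<notin> e ` D \<longrightarrow> M \<bullet> b = 0}"
  define f where "f = (\<lambda>M :: real^'n^'n. \<chi> i j. if h i \<le> h j then M $ i $ j else 0)"
  have e_inj: "inj e"
    by (auto simp: inj_def e_def axis_eq_axis)
  have e_Basis: "Basis = range e"
    by (auto simp: e_def Basis_vec_def image_iff) blast
  have e_inner: "M \<bullet> e ij = M $ fst ij $ snd ij" for M ij
    by (simp add: e_def inner_axis)
  have T: "T = {M. \<forall>i j. \<not> h i \<le> h j \<longrightarrow> M $ i $ j = 0}"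
    unfolding T_def e_Basis by (auto simp: inj_image_mem_iff[OF e_inj] e_inner D_def)
  have "linear f"
    by (auto intro!: linearI simp: f_def vec_eq_iff)
  moreover have "inj_on f Sym"
  proof (rule inj_onI)
    fix M N :: "real^'n^'n"
    assume MN: "M \<in> Sym" "N \<in> Sym" and eq: "f M = f N"
    have up: "M $ i $ j = N $ i $ j" if "h i \<le> h j" for i j
      using that arg_cong[OF eq, of "\<lambda>M. M $ i $ j"] by (simp add: f_def)
    have sym: "M $ i $ j = M $ j $ i" "N $ i $ j = N $ j $ i" for i j
      by (rule Sym_nth[OF MN(1)], rule Sym_nth[OF MN(2)])
    have "M $ i $ j = N $ i $ j" for i j
      using up[of i j] up[of j i] sym[of i j] by (cases "h i \<le> h j") auto
    then show "M = N"
      by (simp add: vec_eq_iff)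
  qed
  moreover have "f ` Sym = T"
  proof
    show "f ` Sym \<subseteq> T"
      by (auto simp: f_def T)
    show "T \<subseteq> f ` Sym"
    proof
      fix M assume M: "M \<in> T"
      define N where "N = (\<chi> i j. if h i \<le> h j then M $ i $ j else M $ j $ i)"
      have "N \<in> Sym"
        using inj by (auto simp: N_def Sym_def transpose_def vec_eq_iff dest: injD)
      moreover have "f N = M"
        using M by (auto simp: f_def N_def T vec_eq_iff)
      ultimately show "M \<in> f ` Sym"
        by blast
    qed
  qed
  ultimately have "dim (Sym :: (real^'n^'n) set) = dim T"
    using dim_image_eq[of f Sym] by (simp add: subspace_Sym span_eq_iff[THEN iffD2])
  also have "\<dots> = card (e ` D)"
    unfolding T_def by (rule dim_substandard) (auto simp: e_Basis)
  also have "\<dots> = card D"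
    by (rule card_image) (use e_inj in \<open>auto simp: inj_on_def\<close>)
  also have "\<dots> = card (SIGMA b:{0..<CARD('n)}. {0..b})"
  proof (rule bij_betw_same_card)
    show "bij_betw (\<lambda>ij. (h (snd ij), h (fst ij))) D (SIGMA b:{0..<CARD('n)}. {0..b})"
    proof (rule bij_betw_imageI)
      show "inj_on (\<lambda>ij. (h (snd ij), h (fst ij))) D"
        using inj by (auto simp: inj_on_def prod_eq_iff)
      show "(\<lambda>ij. (h (snd ij), h (fst ij))) ` D = (SIGMA b:{0..<CARD('n)}. {0..b})"
      proof (intro equalityI subsetI)
        fix x assume "x \<in> (\<lambda>ij. (h (snd ij), h (fst ij))) ` D"
        then show "x \<in> (SIGMA b:{0..<CARD('n)}. {0..b})"
          using bij_betwE[OF h] by (auto simp: D_def)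
      next
        fix x assume x: "x \<in> (SIGMA b:{0..<CARD('n)}. {0..b})"
        then have "fst x \<in> range h" "snd x \<in> range h"
          using bij_betw_imp_surj_on[OF h] by auto
        then obtain i j where "x = (h j, h i)"
          by (metis imageE prod.collapse)
        with x show "x \<in> (\<lambda>ij. (h (snd ij), h (fst ij))) ` D"
          by (auto simp: D_def intro!: image_eqI[of _ _ "(i, j)"])
      qed
    qed
  qed
  also have "\<dots> = (\<Sum>b = 0..<CARD('n). Suc b)"
    by simp
  also have "\<dots> = CARD('n) * (CARD('n) + 1) div 2"
    using gauss_sum_from_Suc_0[of "CARD('n)", where 'a=nat]
    by (simp add: sum.atLeast1_atMost_eq atLeast0LessThan)
  finally show ?thesis .
qed

text \<open>
  To reach a tangent vector \<open>(v, S)\<close>, take a \<open>B\<close> with \<open>B m = v\<close>, which exists as \<open>m \<noteq> 0\<close>,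
  and correct the second component with the constant term \<open>S - (B P + P B\<^sup>T)\<close>.
\<close>

lemma rank_if_full_coefficients:
  fixes X :: "'n::finite state"
  assumes rep: "\<And>F. F \<in> \<FF> \<Longrightarrow> \<exists>p. represents F p"
    and full: "UNIV \<times> Sym \<subseteq> ideal_coefficients \<FF>"
    and X: "X \<in> state_space" "fst X \<noteq> 0"
  shows "fixed_time_accessibility_rank_at \<FF> X"
proof -
  have "{F X | F. F \<in> zero_time_ideal state_space \<FF>} = UNIV \<times> Sym"
  proof
    show "{F X | F. F \<in> zero_time_ideal state_space \<FF>} \<subseteq> UNIV \<times> Sym"
    proof
      fix v
      assume "v \<in> {F X | F. F \<in> zero_time_ideal state_space \<FF>}"
      then obtain F where F: "F \<in> zero_time_ideal state_space \<FF>" and v: "v = F X"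
        by blast
      obtain p where "represents F p"
        using zero_time_ideal_represented[OF F rep] by blast
      from represents_tangent[OF this X(1)] show "v \<in> UNIV \<times> Sym"
        by (simp add: v mem_Times_iff)
    qed
    show "UNIV \<times> Sym \<subseteq> {F X | F. F \<in> zero_time_ideal state_space \<FF>}"
    proof
      fix v :: "'n state"
      assume v: "v \<in> UNIV \<times> Sym"
      define B where "B = outer (fst v) ((1 / (fst X \<bullet> fst X)) *\<^sub>R fst X)"
      have B: "B *v fst X = fst v"
        using X(2) by (simp add: B_def outer_vector_mult)
      have "snd X \<in> Sym"
        using X(1) by (auto simp: state_space_def Sym_pos_def)
      then have "snd v - lyapunov B (snd X) \<in> Sym"
        using v by (auto intro!: subspace_diff[OF subspace_Sym] lyapunov_Sym)
      then have "(B, snd v - lyapunov B (snd X)) \<in> ideal_coefficients \<FF>"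
        using full by blast
      then obtain F where F: "F \<in> zero_time_ideal state_space \<FF>"
        "represents F (B, snd v - lyapunov B (snd X))"
        by (auto simp: ideal_coefficients_def)
      have "F X = v"
        using F(2) X(1) by (simp add: represents_def control_field_apply B prod_eq_iff)
      then show "v \<in> {F X | F. F \<in> zero_time_ideal state_space \<FF>}"
        using F(1) by blast
    qed
  qed
  moreover have "dim (UNIV \<times> Sym :: 'n state set) = CARD('n) + CARD('n) * (CARD('n) + 1) div 2"
    by (subst dim_Times[OF subspace_UNIV subspace_Sym]) (simp add: dim_Sym)
  ultimately show ?thesis
    by (simp add: fixed_time_accessibility_rank_at_def)
qed

section \<open>The controlled family\<close>

lemma gram_Sym: "g ** transpose g \<in> Sym"
  by (simp add: Sym_def matrix_transpose_mul)

lemma represents_drift_field: "represents (drift_field A g) (A, g ** transpose g)"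
  by (auto simp: represents_def drift_field_def control_field_def gram_Sym case_prod_unfold)

lemma represents_control_field: "represents (control_field B) (B, 0)"
  by (auto simp: represents_def subspace_0[OF subspace_Sym] zero_prod_def[symmetric])

lemma represents_family:
  fixes A :: "nat \<Rightarrow> real^'n^'n"
  shows "represents (drift_field (A 0) g + (\<Sum>i=1..nu. u i *\<^sub>R control_field (A i)))
    (A 0 + (\<Sum>i=1..nu. u i *\<^sub>R A i), g ** transpose g)"
proof -
  have "represents (\<Sum>i\<in>I. u i *\<^sub>R control_field (A i)) (\<Sum>i\<in>I. u i *\<^sub>R A i, 0)"
    if "finite I" for I
    using that
  proof (induction I rule: finite_induct)
    case empty
    show ?case
      unfolding sum.empty zero_prod_def[symmetric] by (rule represents_0)
  next
    case (insert i I)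
    then show ?case
      using represents_add[OF represents_scaleR[OF represents_control_field[of "A i"], of "u i"] insert.IH]
      by (simp only: sum.insert[OF insert.hyps] scaleR_Pair add_Pair scaleR_zero_right add_0)
  qed
  from represents_add[OF represents_drift_field[of "A 0" g] this[OF finite_atLeastAtMost]]
  show ?thesis by simp
qed

theorem proposition2p16:
  fixes nu :: nat and A :: "nat \<Rightarrow> real^'n^'n" and g :: "real^'d^'n"
  assumes "dim (Lie (A ` {1..nu})) = CARD('n)^2"
    and "\<exists>i\<in>{1..nu}. A i ** g ** transpose g + g ** transpose g ** transpose (A i) \<noteq> 0"
  shows "\<exists>U \<subseteq> state_space.
    openin (top_of_set state_space) U \<and>
    state_space \<subseteq> closure U \<and>
    (\<forall>X\<in>U. fixed_time_accessibility_rank_at (field_family nu A g) X)"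
proof -
  let ?F = "field_family nu A g" and ?R = "g ** transpose g"
  let ?J = "ideal_coefficients ?F"
  have rep: "\<exists>p. represents F p" if "F \<in> ?F" for F
    using that represents_family unfolding field_family_def by blast
  have drift: "drift_field (A 0) g \<in> ?F"
    unfolding field_family_def by (rule CollectI, rule exI[of _ "\<lambda>_. 0"]) simp
  have control: "drift_field (A 0) g + control_field (A i) \<in> ?F" if "i \<in> {1..nu}" for i
  proof -
    have "(\<Sum>j=1..nu. (if j = i then 1 else 0) *\<^sub>R control_field (A j)) = control_field (A i)"
      using that by (simp add: if_distrib [of "\<lambda>c. c *\<^sub>R _"] cong: if_cong)
    then show ?thesis
      unfolding field_family_def by (intro CollectI exI[of _ "\<lambda>j. if j = i then 1 else 0"]) simp
  qed
  have rep_control: "represents (drift_field (A 0) g + control_field (A i)) (A 0 + A i, ?R)" for i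
    using represents_add[OF represents_drift_field represents_control_field] by fastforce
  have "UNIV \<times> Sym \<subseteq> ?J"
  proof (rule invariant_subspace_full[OF subspace_ideal_coefficients assms(1)])
    fix B assume "B \<in> A ` {1..nu}"
    then obtain i where i: "i \<in> {1..nu}" "B = A i" by blast
    show "(B, 0) \<in> ?J"
      using ideal_coefficients_diff[OF control[OF i(1)] drift rep_control represents_drift_field]
      by (simp add: i)
    fix p assume p: "p \<in> ?J"
    have "affine_bracket (B, 0) p = affine_bracket (A 0 + B, ?R) p - affine_bracket (A 0, ?R) p"
      using linear_diff[OF affine_bracket_linear_left, of "(A 0 + B, ?R)" "(A 0, ?R)" p] by simp
    also have "\<dots> \<in> ?J"
      using ideal_coefficients_invariant[OF rep control[OF i(1)] rep_control p]
        ideal_coefficients_invariant[OF rep drift represents_drift_field p]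
      by (auto simp: i intro: subspace_diff[OF subspace_ideal_coefficients])
    finally show "affine_bracket (B, 0) p \<in> ?J" .
  next
    fix p assume "p \<in> ?J"
    then show "affine_bracket (A 0, ?R) p \<in> ?J"
      using ideal_coefficients_invariant[OF rep drift represents_drift_field] by blast
  next
    show "\<exists>B\<in>A ` {1..nu}. lyapunov B ?R \<noteq> 0"
      using assms(2) by (simp add: lyapunov_def matrix_mul_assoc)
  qed (rule gram_Sym)
  then have rank: "fixed_time_accessibility_rank_at ?F X" if "X \<in> state_space" "fst X \<noteq> 0" for X
    using rank_if_full_coefficients[OF rep] that by blast
  define U where "U = (state_space :: 'n state set) \<inter> {X. fst X \<noteq> 0}"
  have "open {X :: 'n state. fst X \<noteq> 0}"
    by (intro open_Collect_neq continuous_intros)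
  then have "openin (top_of_set state_space) U"
    unfolding U_def by (rule openin_open_Int)
  moreover have "state_space \<subseteq> closure U"
  proof
    fix X :: "'n state"
    assume X: "X \<in> state_space"
    show "X \<in> closure U"
    proof (cases "fst X = 0")
      case True
      show ?thesis
        unfolding closure_approachable
      proof (intro allI impI)
        fix e :: real
        assume "e > 0"
        then obtain w :: "real^'n" where w: "norm w = e / 2"
          using vector_choose_size[of "e / 2"] by auto
        have "(w, snd X) \<in> U"
          using X w \<open>e > 0\<close> by (auto simp: U_def state_space_def)
        moreover have "dist (w, snd X) X < e"
          using True w \<open>e > 0\<close> by (simp add: dist_prod_def)
        ultimately show "\<exists>Y\<in>U. dist Y X < e"
          by blast
      qed
    next
      case False
      then show ?thesis
        using X closure_subset[of U] by (auto simp: U_def)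
    qed
  qed
  ultimately show ?thesis
    using rank by (intro exI[of _ U]) (auto simp: U_def)
qed

end
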